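(* Let $G$ be a finite non-abelian group, $H$ a subgroup of $G$ with $H \neq Z(H,G)$, and $g \in K(H,G)$. If $|H| \neq 2, 3, 4, 6$, then $\Delta_{H,G}^g$ is not a tree.
   Context: For a subgroup $H$ of a finite non-abelian group $G$, write $[x,y] = x^{-1}y^{-1}xy$, $Z(H,G) = \{x \in H : xy = yx \text{ for all } y \in G\}$ and $K(H,G) = \{[x,y] : x \in H,\ y \in G\}$. For $g \in G$, $\Delta_{H,G}^g$ is the simple graph with vertex set $G \setminus Z(H,G)$ in which two distinct vertices $x,y$ are adjacent if and only if ($x \in H$ or $y \in H$) and $[x,y] \neq g$ and $[x,y] \neq g^{-1}$. *)

theory Defs
  imports "HOL-Algebra.Group" "Graph_Theory.Digraph_Component"
begin

definition commutator :: "('a, 'b) monoid_scheme \<Rightarrow> 'a \<Rightarrow> 'a \<Rightarrow> 'a" where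
  "commutator G x y = inv\<^bsub>G\<^esub> x \<otimes>\<^bsub>G\<^esub> inv\<^bsub>G\<^esub> y \<otimes>\<^bsub>G\<^esub> x \<otimes>\<^bsub>G\<^esub> y"

definition rel_center :: "'a set \<Rightarrow> ('a, 'b) monoid_scheme \<Rightarrow> 'a set" where
  "rel_center H G = {x \<in> H. \<forall>y \<in> carrier G. x \<otimes>\<^bsub>G\<^esub> y = y \<otimes>\<^bsub>G\<^esub> x}"

definition rel_commutators :: "'a set \<Rightarrow> ('a, 'b) monoid_scheme \<Rightarrow> 'a set" where
  "rel_commutators H G = {commutator G x y | x y. x \<in> H \<and> y \<in> carrier G}"

text \<open>
  A simple graph is represented by the loopless symmetric digraph that has the two arcs
  \<^term>\<open>(x, y)\<close> and \<^term>\<open>(y, x)\<close> for every undirected edge between \<^term>\<open>x\<close> and \<^term>\<open>y\<close>.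
\<close>

definition noncomm_graph ::
    "'a set \<Rightarrow> ('a, 'b) monoid_scheme \<Rightarrow> 'a \<Rightarrow> 'a pair_pre_digraph" where
  "noncomm_graph H G g =
    \<lparr> pverts = carrier G - rel_center H G,
      parcs = {(x, y). x \<in> carrier G - rel_center H G \<and> y \<in> carrier G - rel_center H G \<and>
                 x \<noteq> y \<and> (x \<in> H \<or> y \<in> H) \<and>
                 commutator G x y \<noteq> g \<and> commutator G x y \<noteq> inv\<^bsub>G\<^esub> g} \<rparr>"

text \<open>
  The library's \<^const>\<open>tree\<close> is not the right notion for this representation: its cycles may
  have length 2, so the walk \<^term>\<open>[(x, y), (y, x)]\<close> along a single undirected edge already
  counts as a cycle. In a simple graph a cycle has at least 3 edges; walks of length at least 3
  that satisfy \<^const>\<open>pre_digraph.cycle\<close> do not repeat vertices or undirected edges.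
  Note that \<^const>\<open>connected\<close> includes non-emptiness of the vertex set.
\<close>

definition simple_graph_tree :: "'a pair_pre_digraph \<Rightarrow> bool" where
  "simple_graph_tree \<Gamma> \<longleftrightarrow>
     connected (with_proj \<Gamma>) \<and>
     \<not> (\<exists>p. pre_digraph.cycle (with_proj \<Gamma>) p \<and> 3 \<le> length p)"

lemma (in group) commutator_swap:
  assumes "x \<in> carrier G" "y \<in> carrier G"
  shows "commutator G y x = inv (commutator G x y)"
  using assms by (simp add: commutator_def inv_mult_group m_assoc)

lemma (in group) commutator_closed:
  assumes "x \<in> carrier G" "y \<in> carrier G"
  shows "commutator G x y \<in> carrier G"
  using assms by (simp add: commutator_def)

text \<open>The adjacency relation is symmetric, so the arcs do encode a finite simple graph.\<close>

lemma (in group) pair_graph_noncomm_graph: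
  assumes "finite (carrier G)" "g \<in> carrier G"
  shows "pair_graph (noncomm_graph H G g)"
proof -
  let ?\<Gamma> = "noncomm_graph H G g"
  have swap: "(y, x) \<in> parcs ?\<Gamma>" if "(x, y) \<in> parcs ?\<Gamma>" for x y
  proof -
    from that have xy: "x \<in> carrier G" "y \<in> carrier G"
      by (auto simp: noncomm_graph_def)
    have "commutator G y x = inv (commutator G x y)"
      using xy by (rule commutator_swap)
    moreover have "inv (commutator G x y) = g \<longleftrightarrow> commutator G x y = inv g"
      using xy assms(2) by (metis commutator_closed inv_inv)
    moreover have "inv (commutator G x y) = inv g \<longleftrightarrow> commutator G x y = g"
      using xy assms(2) by (metis commutator_closed inv_inv)
    ultimately show ?thesis
      using that by (auto simp: noncomm_graph_def)
  qed
  have "parcs ?\<Gamma> \<subseteq> carrier G \<times> carrier G"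
    by (auto simp: noncomm_graph_def)
  then have "finite (parcs ?\<Gamma>)"
    using assms(1) by (meson finite_SigmaI finite_subset)
  moreover have "finite (pverts ?\<Gamma>)"
    using assms(1) by (simp add: noncomm_graph_def)
  moreover have "symmetric (with_proj ?\<Gamma>)"
    using swap by (auto simp: symmetric_def sym_def)
  ultimately show ?thesis
    by unfold_locales (auto simp: noncomm_graph_def)
qed

end

theory Submission
  imports Defs "HOL-Algebra.Group_Action"
begin

text \<open>
  Suppose the graph is a tree, and write \<open>Z\<close> for the relative center of \<open>H\<close>. The element \<open>g\<close>
  decides which pairs are certainly adjacent.

  If \<open>g = \<one>\<close>, adjacency of two vertices, one of them in \<open>H\<close>, means that they do not commute. When
  \<open>H\<close> is not abelian, non-commuting \<open>a, b \<in> H\<close> span the triangle \<open>a, b, ab\<close>. When \<open>H\<close> is abelian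
  with at least three elements, choose \<open>y\<close> outside the centralizer of \<open>H\<close>. The elements of \<open>H\<close> that
  do not commute with \<open>y\<close> form the complement of a proper subgroup of \<open>H\<close>, so there are two of them,
  \<open>a\<close> and \<open>b\<close>; neither commutes with \<open>ya\<close>, and \<open>a, y, b, ya\<close> is a 4-cycle.

  If \<open>g \<noteq> \<one>\<close>, commuting vertices in \<open>H\<close> are adjacent, so no three distinct non-central elements of \<open>H\<close>
  commute pairwise. Two cases remain.

  \<^item> Some \<open>z \<in> Z\<close> is not \<open>\<one>\<close>. For \<open>x \<in> H - Z\<close> the vertices \<open>x\<close> and \<open>xz\<close> are adjacent, and they have
    the same further neighbors because \<open>[xz, v] = [x, v]\<close>. A common neighbor closes a triangle, so
    \<open>{x, xz}\<close> is a connected component. By connectedness it is all of \<open>G - Z\<close>; but then \<open>x\<close> commutes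
    with every vertex and so lies in \<open>Z\<close>.

  \<^item> \<open>Z\<close> is trivial. If \<open>u \<in> H\<close> commutes with \<open>x \<in> H - {\<one>}\<close>, then \<open>x, u, xu\<close> commute pairwise, which
    forces \<open>u \<in> {\<one>, x, x\<inverse>}\<close>. Hence every nontrivial element of \<open>H\<close> has a centralizer of order 2 or 3
    in \<open>H\<close>, so every nontrivial conjugacy class has size \<open>|H|/2\<close> or \<open>|H|/3\<close>. There is no room for
    many such classes, and counting them leaves only \<open>|H| \<in> {1, 2, 3, 6}\<close>.
\<close>

section \<open>Trees among simple graphs\<close>

lemma simple_graph_tree_no_triangle:
  assumes "pair_wf_digraph \<Gamma>" "simple_graph_tree \<Gamma>"
    and "(a, b) \<in> parcs \<Gamma>" "(b, c) \<in> parcs \<Gamma>" "(c, a) \<in> parcs \<Gamma>"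
    and "distinct [a, b, c]"
  shows False
proof -
  have "pre_digraph.awalk (with_proj \<Gamma>) a [(a, b), (b, c), (c, a)] a"
    using assms pair_wf_digraph.in_arcsD1[OF assms(1,3)]
    by (simp add: pre_digraph.awalk_def cas_with_proj_eq)
  then have "pre_digraph.cycle (with_proj \<Gamma>) [(a, b), (b, c), (c, a)]"
    using assms(6) by (auto simp: pre_digraph.cycle_def awalk_verts_with_proj_eq)
  moreover have "3 \<le> length [(a, b), (b, c), (c, a)]" by simp
  ultimately show False using assms(2) unfolding simple_graph_tree_def by blast
qed

lemma simple_graph_tree_no_four_cycle:
  assumes "pair_wf_digraph \<Gamma>" "simple_graph_tree \<Gamma>"
    and "(a, b) \<in> parcs \<Gamma>" "(b, c) \<in> parcs \<Gamma>" "(c, d) \<in> parcs \<Gamma>" "(d, a) \<in> parcs \<Gamma>"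
    and "distinct [a, b, c, d]"
  shows False
proof -
  have "pre_digraph.awalk (with_proj \<Gamma>) a [(a, b), (b, c), (c, d), (d, a)] a"
    using assms pair_wf_digraph.in_arcsD1[OF assms(1,3)]
    by (simp add: pre_digraph.awalk_def cas_with_proj_eq)
  then have "pre_digraph.cycle (with_proj \<Gamma>) [(a, b), (b, c), (c, d), (d, a)]"
    using assms(7) by (auto simp: pre_digraph.cycle_def awalk_verts_with_proj_eq)
  moreover have "3 \<le> length [(a, b), (b, c), (c, d), (d, a)]" by simp
  ultimately show False using assms(2) unfolding simple_graph_tree_def by blast
qed

lemma connected_union_of_components:
  assumes "connected (with_proj \<Gamma>)" "u \<in> pverts \<Gamma>" "u \<in> S"
    and closed: "\<And>a b. (a, b) \<in> parcs \<Gamma> \<Longrightarrow> a \<in> S \<longleftrightarrow> b \<in> S"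
  shows "pverts \<Gamma> \<subseteq> S"
proof
  fix v assume "v \<in> pverts \<Gamma>"
  let ?M = "mk_symmetric (with_proj \<Gamma>)"
  have "(u, v) \<in> (parcs ?M)\<^sup>*"
    using assms(1,2) \<open>v \<in> pverts \<Gamma>\<close>
      reachable_rtranclI[of "with_proj ?M" u v]
    by (simp add: connected_def strongly_connected_def mk_symmetric_def)
  then show "v \<in> S"
    by (induction rule: rtrancl_induct) (use assms(3) closed in \<open>auto simp: mk_symmetric_def\<close>)
qed

section \<open>Groups with small centralizers\<close>

text \<open>
  Conjugation gives every nontrivial class the size \<open>n/2\<close> or \<open>n/3\<close>, where \<open>n\<close> is the order of the
  group: a centralizer contains \<open>\<one>\<close> and the element itself, so it has order 2 or 3. Since \<open>\<one>\<close> needs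
  room as well, at most two nontrivial classes fit, and at most one of them has size \<open>n/2\<close>. For a
  nontrivial group this leaves \<open>n = 1 + n/2\<close>, \<open>n = 1 + 2n/3\<close> and \<open>n = 1 + n/2 + n/3\<close>.
\<close>

lemma (in group) order_of_small_centralizers:
  assumes fin: "finite (carrier G)"
    and small: "\<And>x. x \<in> carrier G \<Longrightarrow> x \<noteq> \<one> \<Longrightarrow>
                  card {y \<in> carrier G. x \<otimes> y = y \<otimes> x} \<le> 3"
  shows "order G \<in> {1, 2, 3, 6}"
proof (rule ccontr)
  assume neg: "order G \<notin> {1, 2, 3, 6}"
  define \<phi> where "\<phi> = (\<lambda>g. (\<lambda>h \<in> carrier G. g \<otimes> h \<otimes> inv g))"
  interpret act: group_action G "carrier G" \<phi>
    unfolding \<phi>_def by (rule action_by_conjugation)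
  define C where "C = orbit G \<phi>"
  have stab: "stabilizer G \<phi> x = {y \<in> carrier G. x \<otimes> y = y \<otimes> x}" if "x \<in> carrier G" for x
  proof -
    have "y \<otimes> x \<otimes> inv y = x \<longleftrightarrow> x \<otimes> y = y \<otimes> x" if "y \<in> carrier G" for y
      using \<open>x \<in> carrier G\<close> that inv_solve_right'[of x "y \<otimes> x" y] by auto
    then show ?thesis using that by (auto simp: stabilizer_def \<phi>_def)
  qed
  have size: "2 * card (C x) = order G \<or> 3 * card (C x) = order G"
    if x: "x \<in> carrier G" "x \<noteq> \<one>" for x
  proof -
    have "{\<one>, x} \<subseteq> stabilizer G \<phi> x" using x by (simp add: stab)
    moreover have "finite (stabilizer G \<phi> x)" using fin x by (simp add: stab)
    ultimately have "2 \<le> card (stabilizer G \<phi> x)"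
      using x(2) card_mono[of "stabilizer G \<phi> x" "{\<one>, x}"] by simp
    moreover have "card (stabilizer G \<phi> x) \<le> 3" using small x by (simp add: stab)
    ultimately have "card (stabilizer G \<phi> x) \<in> {2, 3}" by auto
    with act.orbit_stabilizer_theorem[OF x(1)] show ?thesis
      by (auto simp: C_def mult.commute)
  qed
  have sub: "C x \<subseteq> carrier G" and self: "x \<in> C x" if "x \<in> carrier G" for x
    using that act.orbit_refl by (auto simp: C_def orbit_def \<phi>_def)
  have finC: "finite (C x)" if "x \<in> carrier G" for x
    using sub[OF that] fin finite_subset by blast
  have one_class: "C \<one> = {\<one>}"
    using self[OF one_closed] by (auto simp: C_def orbit_def \<phi>_def)
  have disj: "C x \<inter> C y = {}" if "x \<in> carrier G" "y \<in> carrier G" "y \<notin> C x" for x y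
    using that act.disjoint_union[of "C x" "C y"] self
    by (auto simp: C_def orbits_def)
  have proper: "\<exists>x. x \<in> carrier G \<and> x \<notin> A" if "finite A" "card A < order G" for A
    using that fin card_mono[of A "carrier G"] by (auto simp: order_def)
  have big: "3 < order G"
  proof -
    have "order G \<noteq> 0" using fin order_gt_0_iff_finite by simp
    with neg show ?thesis by auto
  qed
  obtain x where x: "x \<in> carrier G" "x \<noteq> \<one>"
    using proper[of "{\<one>}"] big by auto
  have one_x: "\<one> \<notin> C x" using disj[of \<one> x] x self[of x] one_class by auto
  have card1: "card (insert \<one> (C x)) = 1 + card (C x)" using one_x finC x by simp
  with size[OF x] big have "card (insert \<one> (C x)) < order G" by linarith
  then obtain y where y: "y \<in> carrier G" "y \<noteq> \<one>" "y \<notin> C x"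
    using proper[of "insert \<one> (C x)"] finC x by auto
  have one_y: "\<one> \<notin> C y" using disj[of \<one> y] y self[of y] one_class by auto
  let ?A = "insert \<one> (C x \<union> C y)"
  have card2: "card ?A = 1 + (card (C x) + card (C y))"
    using one_x one_y finC x y disj[of x y] by (simp add: card_Un_disjoint)
  have "?A \<subseteq> carrier G" using sub x y by auto
  then have "card ?A \<le> order G" using fin by (simp add: order_def card_mono)
  \<comment> \<open>Equality would mean \<open>n - 1 = 2n/3\<close> or \<open>n - 1 = n/2 + n/3\<close>, that is \<open>n = 3\<close> or
    \<open>n = 6\<close>; two classes of size \<open>n/2\<close> leave no room for \<open>\<one>\<close>.\<close>
  moreover have "card ?A \<noteq> order G"
    using card2 size[OF x] size[OF y(1,2)] neg by auto
  ultimately have "card ?A < order G" by simp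
  then obtain w where w: "w \<in> carrier G" "w \<noteq> \<one>" "w \<notin> C x" "w \<notin> C y"
    using proper[of ?A] finC x y by auto
  have one_w: "\<one> \<notin> C w" using disj[of \<one> w] w self[of w] one_class by auto
  have "card (insert \<one> (C x \<union> C y \<union> C w)) = 1 + (card (C x) + card (C y) + card (C w))"
    using one_x one_y one_w finC x y w disj[of x y] disj[of x w] disj[of y w]
    by (simp add: card_Un_disjoint Int_Un_distrib2)
  moreover have "insert \<one> (C x \<union> C y \<union> C w) \<subseteq> carrier G" using sub x y w by auto
  then have "card (insert \<one> (C x \<union> C y \<union> C w)) \<le> order G"
    using fin by (simp add: order_def card_mono)
  ultimately show False using size[OF x] size[OF y(1,2)] size[OF w(1,2)] by linarith
qed

section \<open>Adjacency and commuting elements\<close>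

lemma (in group) mult_commutator:
  assumes "x \<in> carrier G" "y \<in> carrier G"
  shows "y \<otimes> x \<otimes> commutator G x y = x \<otimes> y"
proof -
  have "commutator G x y = inv (y \<otimes> x) \<otimes> (x \<otimes> y)"
    using assms by (simp add: commutator_def inv_mult_group m_assoc)
  then show ?thesis
    using assms inv_solve_left[of "commutator G x y" "y \<otimes> x" "x \<otimes> y"] commutator_closed
    by simp
qed

lemma (in group) commutator_eq_one_iff:
  assumes "x \<in> carrier G" "y \<in> carrier G"
  shows "commutator G x y = \<one> \<longleftrightarrow> x \<otimes> y = y \<otimes> x"
proof
  assume "commutator G x y = \<one>"
  then show "x \<otimes> y = y \<otimes> x" using mult_commutator[OF assms] assms by simp
next
  assume "x \<otimes> y = y \<otimes> x"
  then have "(y \<otimes> x) \<otimes> commutator G x y = (y \<otimes> x) \<otimes> \<one>"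
    using mult_commutator[OF assms] assms by simp
  then show "commutator G x y = \<one>"
    using assms commutator_closed[OF assms] by simp
qed

lemma (in group) commutator_mult_central:
  assumes "x \<in> carrier G" "y \<in> carrier G" "z \<in> carrier G"
    and central: "\<And>w. w \<in> carrier G \<Longrightarrow> z \<otimes> w = w \<otimes> z"
  shows "commutator G (x \<otimes> z) y = commutator G x y"
proof -
  have cl: "commutator G (x \<otimes> z) y \<in> carrier G" "commutator G x y \<in> carrier G"
    using assms by (auto intro: commutator_closed)
  have "(y \<otimes> x \<otimes> z) \<otimes> commutator G (x \<otimes> z) y = x \<otimes> z \<otimes> y"
    using mult_commutator[of "x \<otimes> z" y] assms by (simp add: m_assoc)
  also have "\<dots> = x \<otimes> y \<otimes> z" using assms by (simp add: m_assoc)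
  also have "\<dots> = y \<otimes> x \<otimes> commutator G x y \<otimes> z" using assms by (simp add: mult_commutator)
  also have "\<dots> = (y \<otimes> x \<otimes> z) \<otimes> commutator G x y"
    using assms(1-3) cl central[OF cl(2)] by (simp add: m_assoc)
  finally show ?thesis using assms(1-3) cl by simp
qed

lemma (in group) noncomm_graph_sym:
  assumes "finite (carrier G)" "g \<in> carrier G" "(x, y) \<in> parcs (noncomm_graph H G g)"
  shows "(y, x) \<in> parcs (noncomm_graph H G g)"
proof -
  interpret pair_graph "noncomm_graph H G g"
    using assms(1,2) by (rule pair_graph_noncomm_graph)
  show ?thesis using assms(3) pair_sym_arcs by (auto simp: symmetric_def dest: symD)
qed

lemma (in group) arc_of_noncommuting:
  assumes "x \<in> carrier G" "y \<in> carrier G" "x \<in> H \<or> y \<in> H" "x \<otimes> y \<noteq> y \<otimes> x"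
  shows "(x, y) \<in> parcs (noncomm_graph H G \<one>)"
  using assms commutator_eq_one_iff[of x y]
  by (auto simp: noncomm_graph_def rel_center_def) metis+

lemma (in group) arc_of_commuting:
  assumes "g \<in> carrier G" "g \<noteq> \<one>"
    and "x \<in> carrier G - rel_center H G" "y \<in> carrier G - rel_center H G"
    and "x \<in> H \<or> y \<in> H" "x \<noteq> y" "x \<otimes> y = y \<otimes> x"
  shows "(x, y) \<in> parcs (noncomm_graph H G g)"
proof -
  have "commutator G x y = \<one>" using assms commutator_eq_one_iff by auto
  moreover have "\<one> \<noteq> inv g" using assms by (metis inv_inv inv_one)
  ultimately show ?thesis using assms by (auto simp: noncomm_graph_def)
qed

section \<open>Acyclicity for the trivial commutator\<close>

lemma (in group) commutative_subgroup_if_tree_one: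
  assumes fin: "finite (carrier G)" and H: "subgroup H G"
    and tree: "simple_graph_tree (noncomm_graph H G \<one>)"
    and ab: "a \<in> H" "b \<in> H"
  shows "a \<otimes> b = b \<otimes> a"
proof (rule ccontr)
  assume ne: "a \<otimes> b \<noteq> b \<otimes> a"
  interpret \<Gamma>: pair_graph "noncomm_graph H G \<one>"
    using fin by (simp add: pair_graph_noncomm_graph)
  note c = subgroup.mem_carrier[OF H ab(1)] subgroup.mem_carrier[OF H ab(2)]
  have neb: "b \<otimes> (a \<otimes> b) \<noteq> (a \<otimes> b) \<otimes> b"
    using ne c by (simp add: m_assoc[symmetric])
  have nea: "(a \<otimes> b) \<otimes> a \<noteq> a \<otimes> (a \<otimes> b)"
    using ne c by (simp add: m_assoc)
  have "distinct [a, b, a \<otimes> b]" using ne neb nea by auto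
  then show False
    using simple_graph_tree_no_triangle[OF \<Gamma>.pair_wf_digraph_axioms tree, of a b "a \<otimes> b"]
      arc_of_noncommuting ab c ne neb nea by simp
qed

text \<open>
  In an abelian \<open>H\<close> the elements that commute with \<open>y\<close> form a proper subgroup. Translating by one of
  its elements turns one element outside it into another, so two elements \<open>a\<close>, \<open>b\<close> outside it exist
  as soon as \<open>H\<close> has a third element \<open>h\<close> besides \<open>\<one>\<close> and \<open>a\<close>. Multiplying \<open>y\<close> by an element of \<open>H\<close>
  does not change which elements of \<open>H\<close> commute with it, so \<open>ya\<close> can serve as the fourth vertex.
\<close>

lemma (in group) not_tree_one:
  assumes fin: "finite (carrier G)" and H: "subgroup H G"
    and Z: "H \<noteq> rel_center H G" and card: "3 \<le> card H"
  shows "\<not> simple_graph_tree (noncomm_graph H G \<one>)"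
proof
  assume tree: "simple_graph_tree (noncomm_graph H G \<one>)"
  interpret \<Gamma>: pair_graph "noncomm_graph H G \<one>"
    using fin by (simp add: pair_graph_noncomm_graph)
  note comm = commutative_subgroup_if_tree_one[OF fin H tree]
  note c = subgroup.mem_carrier[OF H]
  obtain a y where a: "a \<in> H" and y: "y \<in> carrier G" and ay: "a \<otimes> y \<noteq> y \<otimes> a"
    using Z by (auto simp: rel_center_def)
  have "\<not> H \<subseteq> {\<one>, a}"
    using card card_mono[of "{\<one>, a}" H] card_insert_le_m1[of 2 "{a}" \<one>] by auto
  then obtain h where h: "h \<in> H" "h \<noteq> \<one>" "h \<noteq> a" by auto
  obtain b where b: "b \<in> H" "b \<noteq> a" "b \<otimes> y \<noteq> y \<otimes> b"
  proof (cases "h \<otimes> y = y \<otimes> h")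
    case True
    have "(a \<otimes> h) \<otimes> y = a \<otimes> y \<otimes> h" "y \<otimes> (a \<otimes> h) = y \<otimes> a \<otimes> h"
      using True a h y c by (auto simp: m_assoc)
    with ay have "(a \<otimes> h) \<otimes> y \<noteq> y \<otimes> (a \<otimes> h)" using a h y c by simp
    moreover have "a \<otimes> h \<noteq> a" using a h c by simp
    ultimately show ?thesis using that[of "a \<otimes> h"] a h subgroup.m_closed[OF H] by blast
  next
    case False
    then show ?thesis using that h by blast
  qed
  have nH: "y \<notin> H" using ay a comm by blast
  have shift: "k \<otimes> (y \<otimes> a) \<noteq> (y \<otimes> a) \<otimes> k" if k: "k \<in> H" "k \<otimes> y \<noteq> y \<otimes> k" for k
  proof -
    have "k \<otimes> (y \<otimes> a) = k \<otimes> y \<otimes> a" using k a y c by (simp add: m_assoc)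
    moreover have "(y \<otimes> a) \<otimes> k = y \<otimes> k \<otimes> a"
      using k a y c comm[of a k] by (simp add: m_assoc)
    ultimately show ?thesis using k a y c by simp
  qed
  have "a \<noteq> \<one>" using ay y by auto
  then have "y \<otimes> a \<noteq> y" using a y c by simp
  moreover have "y \<otimes> a \<notin> H"
  proof
    assume "y \<otimes> a \<in> H"
    then have "y \<otimes> a \<otimes> inv a \<in> H"
      using a H by (meson subgroup.m_closed subgroup.m_inv_closed)
    then show False using nH a y c by (simp add: m_assoc)
  qed
  ultimately have "distinct [a, y, b, y \<otimes> a]" using a b nH by auto
  moreover have "(a, y) \<in> parcs (noncomm_graph H G \<one>)" "(y, b) \<in> parcs (noncomm_graph H G \<one>)"
    "(b, y \<otimes> a) \<in> parcs (noncomm_graph H G \<one>)" "(y \<otimes> a, a) \<in> parcs (noncomm_graph H G \<one>)"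
    using arc_of_noncommuting a b y c ay shift[OF a ay] shift[OF b(1,3)] m_closed by metis+
  ultimately show False
    using simple_graph_tree_no_four_cycle[OF \<Gamma>.pair_wf_digraph_axioms tree] by blast
qed

section \<open>Trees for nontrivial commutators\<close>

text \<open>
  A nontrivial \<open>z\<close> in the relative center makes \<open>x\<close> and \<open>xz\<close> adjacent twins, which an acyclic graph
  allows only if they form a component of their own.
\<close>

lemma (in group) rel_center_trivial_if_tree:
  assumes fin: "finite (carrier G)" and H: "subgroup H G"
    and g: "g \<in> carrier G" "g \<noteq> \<one>"
    and Z: "H \<noteq> rel_center H G"
    and tree: "simple_graph_tree (noncomm_graph H G g)"
  shows "rel_center H G = {\<one>}"
proof (rule ccontr)
  let ?\<Gamma> = "noncomm_graph H G g"
  assume "rel_center H G \<noteq> {\<one>}"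
  moreover have "\<one> \<in> rel_center H G"
    using subgroup.one_closed[OF H] by (simp add: rel_center_def)
  ultimately obtain z where z: "z \<in> rel_center H G" "z \<noteq> \<one>" by blast
  interpret \<Gamma>: pair_graph ?\<Gamma> using fin g by (simp add: pair_graph_noncomm_graph)
  note c = subgroup.mem_carrier[OF H]
  have zH: "z \<in> H" "z \<in> carrier G" and central: "\<And>w. w \<in> carrier G \<Longrightarrow> z \<otimes> w = w \<otimes> z"
    using z c by (auto simp: rel_center_def)
  obtain x where x: "x \<in> H" "x \<notin> rel_center H G"
    using Z by (auto simp: rel_center_def)
  then obtain v where v: "v \<in> carrier G" "x \<otimes> v \<noteq> v \<otimes> x" by (auto simp: rel_center_def)
  have xz: "x \<otimes> z \<in> H" "x \<otimes> z \<in> carrier G" "x \<otimes> z \<noteq> x"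
    using x zH z(2) c subgroup.m_closed[OF H] by auto
  have comm: "x \<otimes> (x \<otimes> z) = (x \<otimes> z) \<otimes> x"
    using x zH c central[of x] by (simp add: m_assoc)
  have xz_nc: "x \<otimes> z \<notin> rel_center H G"
  proof
    assume "x \<otimes> z \<in> rel_center H G"
    then have "commutator G (x \<otimes> z) v = \<one>"
      using v xz by (simp add: rel_center_def commutator_eq_one_iff)
    then have "commutator G x v = \<one>"
      using commutator_mult_central[of x v z] v x zH c central by simp
    then show False using v x c commutator_eq_one_iff by simp
  qed
  have twin: "(x, w) \<in> parcs ?\<Gamma> \<longleftrightarrow> (x \<otimes> z, w) \<in> parcs ?\<Gamma>" if "w \<noteq> x" "w \<noteq> x \<otimes> z" for w
    using that x xz xz_nc c zH central commutator_mult_central[of x w z]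
    by (auto simp: noncomm_graph_def)
  have edge: "(x, x \<otimes> z) \<in> parcs ?\<Gamma>"
    using arc_of_commuting[OF g, of x H "x \<otimes> z"] x xz xz_nc comm c by auto
  have leaf: "w \<in> {x, x \<otimes> z}" if "(x, w) \<in> parcs ?\<Gamma> \<or> (x \<otimes> z, w) \<in> parcs ?\<Gamma>" for w
  proof (rule ccontr)
    assume w: "w \<notin> {x, x \<otimes> z}"
    then have "(x \<otimes> z, w) \<in> parcs ?\<Gamma>" "(w, x) \<in> parcs ?\<Gamma>"
      using twin that noncomm_graph_sym[OF fin g(1)] by blast+
    then show False
      using simple_graph_tree_no_triangle[OF \<Gamma>.pair_wf_digraph_axioms tree edge, of w] w xz by auto
  qed
  have "pverts ?\<Gamma> \<subseteq> {x, x \<otimes> z}"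
  proof (rule connected_union_of_components)
    show "connected (with_proj ?\<Gamma>)" using tree by (simp add: simple_graph_tree_def)
    show "x \<in> pverts ?\<Gamma>" using x c by (simp add: noncomm_graph_def)
    show "a \<in> {x, x \<otimes> z} \<longleftrightarrow> b \<in> {x, x \<otimes> z}" if "(a, b) \<in> parcs ?\<Gamma>" for a b
      using that leaf noncomm_graph_sym[OF fin g(1) that] by blast
  qed simp
  moreover have "v \<notin> rel_center H G"
  proof
    assume "v \<in> rel_center H G"
    then have "v \<otimes> x = x \<otimes> v" using c[OF x(1)] by (simp add: rel_center_def)
    with v show False by simp
  qed
  then have "v \<in> pverts ?\<Gamma>" using v by (simp add: noncomm_graph_def)
  ultimately show False using v comm by auto
qed

text \<open>
  The product of two commuting elements commutes with both, so commuting \<open>x\<close> and \<open>u\<close> give the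
  triangle \<open>x, u, xu\<close> unless it degenerates.
\<close>

lemma (in group) centralizer_if_tree:
  assumes fin: "finite (carrier G)" and H: "subgroup H G"
    and g: "g \<in> carrier G" "g \<noteq> \<one>"
    and Z: "rel_center H G = {\<one>}"
    and tree: "simple_graph_tree (noncomm_graph H G g)"
    and x: "x \<in> H" "x \<noteq> \<one>"
  shows "{u \<in> H. x \<otimes> u = u \<otimes> x} \<subseteq> {\<one>, x, inv x}"
proof (rule ccontr)
  interpret \<Gamma>: pair_graph "noncomm_graph H G g" using fin g by (simp add: pair_graph_noncomm_graph)
  note c = subgroup.mem_carrier[OF H]
  assume "\<not> ?thesis"
  then obtain u where u: "u \<in> H" "x \<otimes> u = u \<otimes> x" "u \<noteq> \<one>" "u \<noteq> x" "u \<noteq> inv x" by auto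
  have xu: "x \<otimes> u \<in> H" "x \<otimes> u \<noteq> x" "x \<otimes> u \<noteq> u"
    using x u c subgroup.m_closed[OF H] by auto
  have xu1: "x \<otimes> u \<noteq> \<one>"
    using u x c by (metis inv_equality)
  have "u \<otimes> (x \<otimes> u) = (x \<otimes> u) \<otimes> u" "(x \<otimes> u) \<otimes> x = x \<otimes> (x \<otimes> u)"
    using u x c by (metis m_assoc)+
  then have "(x, u) \<in> parcs (noncomm_graph H G g)" "(u, x \<otimes> u) \<in> parcs (noncomm_graph H G g)"
    "(x \<otimes> u, x) \<in> parcs (noncomm_graph H G g)"
    using x u xu xu1 c Z by (auto intro!: arc_of_commuting[OF g])
  then show False
    using simple_graph_tree_no_triangle[OF \<Gamma>.pair_wf_digraph_axioms tree, of x u "x \<otimes> u"] u xu by auto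
qed

section \<open>Excluding trees\<close>

theorem theorem2p3:
  fixes G :: "('a, 'b) monoid_scheme" and H :: "'a set" and g :: 'a
  assumes "group G"
    and "finite (carrier G)"
    and "\<not> comm_group G"
    and "subgroup H G"
    and "H \<noteq> rel_center H G"
    and "g \<in> rel_commutators H G"
    and "card H \<notin> {2, 3, 4, 6}"
  shows "\<not> simple_graph_tree (noncomm_graph H G g)"
proof
  assume tree: "simple_graph_tree (noncomm_graph H G g)"
  interpret group G by fact
  note fin = assms(2) and H = assms(4) and Z = assms(5)
  have sub: "H \<subseteq> carrier G" using H by (rule subgroup.subset)
  have finH: "finite H" using sub fin finite_subset by blast
  have one: "\<one>\<^bsub>G\<^esub> \<in> H" using H by (rule subgroup.one_closed)
  have g: "g \<in> carrier G"
    using assms(6) sub commutator_closed by (auto simp: rel_commutators_def)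
  have card1: "card H \<noteq> 1"
  proof
    assume "card H = 1"
    then have "H = {\<one>\<^bsub>G\<^esub>}" using one by (auto simp: card_1_singleton_iff)
    then show False using Z by (auto simp: rel_center_def)
  qed
  have "card H \<noteq> 0" using one finH by auto
  then have card3: "3 \<le> card H" using card1 assms(7) by auto
  show False
  proof (cases "g = \<one>\<^bsub>G\<^esub>")
    case True
    then show False using not_tree_one[OF fin H Z card3] tree by simp
  next
    case False
    note triv = rel_center_trivial_if_tree[OF fin H g False Z tree]
    interpret K: group "G\<lparr>carrier := H\<rparr>" using H by (rule subgroup.subgroup_is_group) fact
    have "card {u \<in> H. x \<otimes>\<^bsub>G\<^esub> u = u \<otimes>\<^bsub>G\<^esub> x} \<le> 3" if "x \<in> H" "x \<noteq> \<one>\<^bsub>G\<^esub>" for x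
    proof -
      have "card {u \<in> H. x \<otimes>\<^bsub>G\<^esub> u = u \<otimes>\<^bsub>G\<^esub> x} \<le> card {\<one>\<^bsub>G\<^esub>, x, inv\<^bsub>G\<^esub> x}"
        using centralizer_if_tree[OF fin H g False triv tree that] by (simp add: card_mono)
      also have "\<dots> \<le> 3" by (simp add: card_insert_if)
      finally show ?thesis .
    qed
    then have "order (G\<lparr>carrier := H\<rparr>) \<in> {1, 2, 3, 6}"
      using finH by (intro K.order_of_small_centralizers) auto
    then show False using card1 assms(7) by (auto simp: order_def)
  qed
qed

end
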